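(* For any given $\mathbf B^c(k)\ne\mathbf 0$, every $\mathbf T\in\mathbb S_+^S$ can be decomposed into a sum of two positive semidefinite matrices $$\mathbf T=\mathbf T_k^{\mathrm{ker}}+\mathbf T_k^{\mathbf 0},\qquad \mathbf T_k^{\mathrm{ker}}\in\mathcal T_k^{\mathrm{ker}},\quad \mathbf T_k^{\mathbf 0}\in\mathcal T_k^{\mathbf 0}.$$ Closed-form expressions are $\mathbf T_k^{\mathrm{ker}}=(\widetilde{\mathbf T}_k^{\mathrm{ker}})^T\widetilde{\mathbf T}_k^{\mathrm{ker}}$ and $\mathbf T_k^{\mathbf 0}=(\widetilde{\mathbf T}_k^{\mathbf 0})^T\widetilde{\mathbf T}_k^{\mathbf 0}$, where $$\widetilde{\mathbf T}_k^{\mathrm{ker}}=\begin{bmatrix}(\mathbf U_k\mathbf T\mathbf U_k^T)_{r_k}^{1/2}\\ \mathbf L_k(\mathbf U_k\mathbf T\mathbf U_k^T)_{r_k}^{1/2}\end{bmatrix}^T\mathbf U_k,\qquad \widetilde{\mathbf T}_k^{\mathbf 0}=\begin{bmatrix}\mathbf 0_{r_k\times S}\\ [-\mathbf L_k,\ \mathbf I_{S-r_k}](\mathbf U_k\mathbf T\mathbf U_k^T)^{1/2}\end{bmatrix}^T\mathbf U_k,$$ and $\mathbf L_k=(\mathbf U_k\mathbf T\mathbf U_k^T)_{(1:r_k;\,r_k+1:S)}^T\,(\mathbf U_k\mathbf T\mathbf U_k^T)_{r_k}^{-1}$.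
   Context: $\mathbb S_+^S$ and $\hat{\mathbb S}_+^S$ are the sets of real symmetric positive definite, respectively positive semidefinite, $S\times S$ matrices. $\mathbf B^c(k)\in\mathbb R^{S\times n}$ is a (realization of a random) real matrix, $\mathbf R^c\in\mathbb S_+^n$. For a matrix $\mathbf M$, $\mathrm{ker}(\mathbf M)$ denotes the left kernel; $(\mathbf M)_r$ denotes the $r$-th order leading principal submatrix ($(\mathbf M)_r^{1/2}$, $(\mathbf M)_r^{-1}$ are its square root and inverse); $(\mathbf M)_{(i:j;\,l:m)}$ is the submatrix with rows $i,\dots,j$ and columns $l,\dots,m$ (blocks of size zero are absent). Define $$\mathcal T_k^{\mathrm{ker}}=\{\widetilde{\mathbf T}\in\hat{\mathbb S}_+^S:\ \mathrm{ker}(\widetilde{\mathbf T}\mathbf B^c(k))=\mathrm{ker}(\widetilde{\mathbf T})\},\qquad \mathcal T_k^{\mathbf 0}=\{\widetilde{\mathbf T}\in\hat{\mathbb S}_+^S:\ \widetilde{\mathbf T}\mathbf B^c(k)=\mathbf 0\}.$$ Let $r_k=\mathrm{rank}(\mathbf B^c(k))$ and take a singular value decomposition $$\mathbf B^c(k)(\mathbf R^c)^{-1}\mathbf B^c(k)^T=\mathbf U_k^T\boldsymbol\Sigma_k\mathbf U_k=\mathbf U_k^T\,\mathrm{diag}\big((\boldsymbol\Sigma_k)_{r_k},\mathbf 0_{S-r_k}\big)\mathbf U_k,$$ with $\mathbf U_k\in\mathbb R^{S\times S}$ orthogonal and $\boldsymbol\Sigma_k$ diagonal with diagonal entries in descending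 order. *)

theory Defs
  imports
    "Jordan_Normal_Form.Matrix"
    "Jordan_Normal_Form.Gauss_Jordan_Elimination"
    "Jordan_Normal_Form.Matrix_Kernel"
    "Jordan_Normal_Form.DL_Rank"
    "Jordan_Normal_Form.DL_Submatrix"
begin

definition pos_semidef_mats :: "nat \<Rightarrow> real mat set" where
  "pos_semidef_mats m =
     {A \<in> carrier_mat m m. transpose_mat A = A \<and>
        (\<forall>v \<in> carrier_vec m. 0 \<le> v \<bullet> (A *\<^sub>v v))}"

definition pos_def_mats :: "nat \<Rightarrow> real mat set" where
  "pos_def_mats m =
     {A \<in> carrier_mat m m. transpose_mat A = A \<and>
        (\<forall>v \<in> carrier_vec m. v \<noteq> 0\<^sub>v m \<longrightarrow> 0 < v \<bullet> (A *\<^sub>v v))}"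

definition left_kernel :: "real mat \<Rightarrow> real vec set" where
  "left_kernel M = mat_kernel (transpose_mat M)"

definition T_ker :: "nat \<Rightarrow> real mat \<Rightarrow> real mat set" where
  "T_ker S B = {X \<in> pos_semidef_mats S. left_kernel (X * B) = left_kernel X}"

definition T_zero :: "nat \<Rightarrow> real mat \<Rightarrow> real mat set" where
  "T_zero S B = {X \<in> pos_semidef_mats S. X * B = 0\<^sub>m S (dim_col B)}"

text \<open>The inverse and the square root below are meaningful for invertible, respectively
  positive semidefinite, arguments only; the square root is the unique positive semidefinite one.\<close>

definition inv_mat :: "real mat \<Rightarrow> real mat" where
  "inv_mat A = the (mat_inverse A)"

definition sqrt_mat :: "real mat \<Rightarrow> real mat" where
  "sqrt_mat A = (THE X. X \<in> pos_semidef_mats (dim_row A) \<and> X * X = A)"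

definition leading_submatrix :: "real mat \<Rightarrow> nat \<Rightarrow> real mat" where
  "leading_submatrix A r = submatrix A {..<r} {..<r}"

definition append_cols :: "real mat \<Rightarrow> real mat \<Rightarrow> real mat" where
  "append_cols A B = four_block_mat A B (0\<^sub>m 0 (dim_col A)) (0\<^sub>m 0 (dim_col B))"

text \<open>Singular value decomposition \<open>M = U\<^sup>T \<Sigma> U\<close> of a symmetric positive semidefinite matrix:
  the left and right singular vectors coincide, and they are the rows of \<open>U\<close>.\<close>

definition is_svd :: "nat \<Rightarrow> real mat \<Rightarrow> real mat \<Rightarrow> real mat \<Rightarrow> bool" where
  "is_svd m M U \<Sigma> \<longleftrightarrow>
     U \<in> carrier_mat m m \<and> transpose_mat U * U = 1\<^sub>m m \<and> U * transpose_mat U = 1\<^sub>m m \<and>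
     \<Sigma> \<in> carrier_mat m m \<and> diagonal_mat \<Sigma> \<and>
     (\<forall>i<m. 0 \<le> \<Sigma> $$ (i, i)) \<and>
     (\<forall>i j. i \<le> j \<and> j < m \<longrightarrow> \<Sigma> $$ (j, j) \<le> \<Sigma> $$ (i, i)) \<and>
     M = transpose_mat U * \<Sigma> * U"

definition L_mat :: "nat \<Rightarrow> nat \<Rightarrow> real mat \<Rightarrow> real mat \<Rightarrow> real mat" where
  "L_mat S r U T =
     (let A = U * T * transpose_mat U in
      transpose_mat (submatrix A {..<r} {r..<S}) * inv_mat (leading_submatrix A r))"

definition T_ker_factor :: "nat \<Rightarrow> nat \<Rightarrow> real mat \<Rightarrow> real mat \<Rightarrow> real mat" where
  "T_ker_factor S r U T =
     (let Q = sqrt_mat (leading_submatrix (U * T * transpose_mat U) r) in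
      transpose_mat (Q @\<^sub>r (L_mat S r U T * Q)) * U)"

definition T_zero_factor :: "nat \<Rightarrow> nat \<Rightarrow> real mat \<Rightarrow> real mat \<Rightarrow> real mat" where
  "T_zero_factor S r U T =
     transpose_mat
       (0\<^sub>m r S @\<^sub>r
        (append_cols (- L_mat S r U T) (1\<^sub>m (S - r)) * sqrt_mat (U * T * transpose_mat U))) * U"

end

theory Submission
  imports Defs "Jordan_Normal_Form.Schur_Decomposition" "Jordan_Normal_Form.Spectral_Radius"
begin

text \<open>In the basis given by the rows of \<open>U\<close> the matrix \<open>B\<close> becomes \<open>U B = J C\<close>, where \<open>J\<close> is the
  inclusion of the first \<open>r\<close> coordinates and \<open>C\<close> has a right inverse. Put \<open>A = U T U\<^sup>T\<close>,
  \<open>A\<^sub>1 = J\<^sup>T A J\<close> and \<open>Y = [I; L]\<close>, so that \<open>Y A\<^sub>1 = A J\<close>, and let \<open>K = Y A\<^sub>1 Y\<^sup>T\<close>.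
  The closed forms are \<open>U\<^sup>T K U\<close> and \<open>U\<^sup>T (A - K) U\<close>; the remainder \<open>A - K\<close> is the Schur
  complement of \<open>A\<^sub>1\<close> padded with zeros, and equals \<open>Z A Z\<^sup>T\<close> for \<open>Z = I - Y J\<^sup>T = [0; -L, I]\<close>.
  Since \<open>K J = A J\<close>, the second part annihilates \<open>B\<close>. Since \<open>K = Y J\<^sup>T A = Y (K J)\<^sup>T\<close> and \<open>C\<close> can be
  cancelled, the first part is a matrix times the transpose of its product with \<open>B\<close>, so that the
  two left kernels agree.\<close>

section \<open>Positive definite matrices\<close>

text \<open>The side conditions are equations between dimensions of the matrices at hand, with no
  extra size variables to guess. The simplifier can therefore reassociate long products unaided; the
  transposition rule has the same form for the same purpose.\<close>

lemma mult_mat_assoc_dim: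
  fixes A B C :: "'a :: semiring_0 mat"
  assumes "dim_col A = dim_row B" "dim_col B = dim_row C"
  shows "A * B * C = A * (B * C)"
  using assms by (intro assoc_mult_mat[of _ "dim_row A" "dim_col A" _ "dim_row C" _ "dim_col C"]) auto

lemma transpose_mult_dim:
  fixes A B :: "'a :: comm_semiring_0 mat"
  assumes "dim_col A = dim_row B"
  shows "transpose_mat (A * B) = transpose_mat B * transpose_mat A"
  using assms by (intro transpose_mult[of _ "dim_row A" "dim_row B" _ "dim_col B"]) auto

lemma scalar_prod_congruence:
  fixes A X :: "real mat"
  assumes A: "A \<in> carrier_mat n n" and X: "X \<in> carrier_mat m n" and v: "v \<in> carrier_vec m"
  shows "v \<bullet> (X * A * transpose_mat X *\<^sub>v v) = (transpose_mat X *\<^sub>v v) \<bullet> (A *\<^sub>v (transpose_mat X *\<^sub>v v))"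
proof -
  have "X * A * transpose_mat X *\<^sub>v v = X *\<^sub>v (A *\<^sub>v (transpose_mat X *\<^sub>v v))"
    using A X v by (simp add: assoc_mult_mat_vec[of _ m n _ m] assoc_mult_mat_vec[of _ m n _ n])
  then show ?thesis
    using transpose_vec_mult_scalar[OF X, of "A *\<^sub>v (transpose_mat X *\<^sub>v v)" v] A X v by simp
qed

lemma symmetric_congruence:
  fixes A X :: "real mat"
  assumes "A \<in> carrier_mat n n" "transpose_mat A = A" "X \<in> carrier_mat m n"
  shows "transpose_mat (X * A * transpose_mat X) = X * A * transpose_mat X"
  using assms by (simp add: transpose_mult_dim mult_mat_assoc_dim)

lemma pos_semidef_congruence:
  assumes A: "A \<in> pos_semidef_mats n" and X: "X \<in> carrier_mat m n"
  shows "X * A * transpose_mat X \<in> pos_semidef_mats m"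
  using A X unfolding pos_semidef_mats_def
  by (auto simp: symmetric_congruence[of A n X m] scalar_prod_congruence[of A n X m])

lemma one_pos_semidef: "1\<^sub>m n \<in> pos_semidef_mats n"
  unfolding pos_semidef_mats_def by (simp, simp add: scalar_prod_def sum_nonneg)

lemma gram_pos_semidef:
  assumes X: "X \<in> carrier_mat m n"
  shows "transpose_mat X * X \<in> pos_semidef_mats n"
  using pos_semidef_congruence[OF one_pos_semidef[of m], of "transpose_mat X" n] X by simp

lemma mult_mat_zero_vec:
  fixes A :: "'a :: semiring_0 mat"
  assumes "A \<in> carrier_mat m n"
  shows "A *\<^sub>v 0\<^sub>v n = 0\<^sub>v m"
  using assms by (intro eq_vecI) auto

text \<open>The right inverse \<open>Y\<close> makes \<open>X\<^sup>T\<close> injective, since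
  \<open>Y\<^sup>T X\<^sup>T = I\<close>; a nonzero \<open>v\<close> thus yields the nonzero vector
  \<open>X\<^sup>T v\<close> on which \<open>A\<close> is positive.\<close>

lemma pos_def_congruence:
  assumes A: "A \<in> pos_def_mats n" and X: "X \<in> carrier_mat m n" and Y: "Y \<in> carrier_mat n m"
    and XY: "X * Y = 1\<^sub>m m"
  shows "X * A * transpose_mat X \<in> pos_def_mats m"
proof -
  have "transpose_mat X *\<^sub>v v \<noteq> 0\<^sub>v n" if v: "v \<in> carrier_vec m" "v \<noteq> 0\<^sub>v m" for v
  proof
    assume "transpose_mat X *\<^sub>v v = 0\<^sub>v n"
    then have "transpose_mat (X * Y) *\<^sub>v v = 0\<^sub>v m"
      using X Y v by (simp add: transpose_mult_dim assoc_mult_mat_vec[of _ m n _ m] mult_mat_zero_vec[of _ m n])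
    then show False using XY v by simp
  qed
  then show ?thesis
    using A X unfolding pos_def_mats_def
    by (auto simp: symmetric_congruence[of A n X m] scalar_prod_congruence[of A n X m])
qed

lemma pos_def_imp_pos_semidef:
  assumes "A \<in> pos_def_mats n"
  shows "A \<in> pos_semidef_mats n"
proof -
  have "0 \<le> v \<bullet> (A *\<^sub>v v)" if "v \<in> carrier_vec n" for v
    using assms that by (cases "v = 0\<^sub>v n") (auto simp: pos_def_mats_def less_imp_le)
  then show ?thesis using assms by (simp add: pos_def_mats_def pos_semidef_mats_def)
qed

text \<open>A nonzero kernel vector would make the quadratic form vanish, so the determinant is
  nonzero and \<open>mat_inverse\<close> succeeds. This justifies the \<open>the\<close> in
  \<open>inv_mat\<close>.\<close>

lemma pos_def_inv_mat:
  assumes A: "A \<in> pos_def_mats n"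
  shows "inv_mat A \<in> carrier_mat n n" "A * inv_mat A = 1\<^sub>m n" "inv_mat A * A = 1\<^sub>m n"
proof -
  have Ac: "A \<in> carrier_mat n n" using A by (simp add: pos_def_mats_def)
  have "det A \<noteq> 0"
  proof
    assume "det A = 0"
    then obtain v where "v \<in> carrier_vec n" "v \<noteq> 0\<^sub>v n" "A *\<^sub>v v = 0\<^sub>v n"
      using det_0_iff_vec_prod_zero_field[OF Ac] by auto
    then show False using A unfolding pos_def_mats_def by force
  qed
  then have "mat_inverse A \<noteq> None"
    using mat_inverse(1)[OF Ac] det_non_zero_imp_unit[OF Ac] by metis
  then have "mat_inverse A = Some (inv_mat A)" by (auto simp: inv_mat_def)
  from mat_inverse(2)[OF Ac this]
  show "inv_mat A \<in> carrier_mat n n" "A * inv_mat A = 1\<^sub>m n" "inv_mat A * A = 1\<^sub>m n" by auto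
qed

text \<open>The inverse is the congruence of \<open>A\<close> by its own inverse, because it equals
  its transpose; the right inverse that strict positivity requires is \<open>A\<close>
  itself.\<close>

lemma pos_def_inv:
  assumes A: "A \<in> pos_def_mats n"
  shows "inv_mat A \<in> pos_def_mats n"
proof -
  note inv = pos_def_inv_mat[OF A]
  have Ac: "A \<in> carrier_mat n n" and At: "transpose_mat A = A" using A by (auto simp: pos_def_mats_def)
  have "transpose_mat (inv_mat A) * A = 1\<^sub>m n"
    using arg_cong[OF inv(2), of transpose_mat] inv(1) Ac At by (simp add: transpose_mult_dim)
  then have "inv_mat A * A * transpose_mat (inv_mat A) = transpose_mat (inv_mat A)"
    using inv Ac by simp
  moreover have "transpose_mat (inv_mat A) = transpose_mat (inv_mat A) * (A * inv_mat A)"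
    using inv Ac by simp
  moreover have "\<dots> = inv_mat A"
    using \<open>transpose_mat (inv_mat A) * A = 1\<^sub>m n\<close> inv(1) Ac
    by (simp add: mult_mat_assoc_dim[symmetric])
  ultimately show ?thesis
    using pos_def_congruence[OF A inv(1) Ac inv(3)] by simp
qed

lemma pos_semidef_diag_nonneg:
  assumes A: "A \<in> pos_semidef_mats n" and i: "i < n"
  shows "0 \<le> A $$ (i, i)"
proof -
  have Ac: "A \<in> carrier_mat n n" using A by (simp add: pos_semidef_mats_def)
  have "0 \<le> unit_vec n i \<bullet> (A *\<^sub>v unit_vec n i)"
    using A unfolding pos_semidef_mats_def by simp
  then show ?thesis using Ac i by (simp add: scalar_prod_left_unit[of _ n])
qed

section \<open>Orthogonal diagonalization and square roots\<close>

text \<open>Over the complex numbers an eigenvalue exists, and symmetry forces it to be real; it is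
  then a root of the real characteristic polynomial.\<close>

lemma symmetric_eigenvalue_exists:
  fixes M :: "real mat"
  assumes M: "M \<in> carrier_mat n n" and sym: "transpose_mat M = M" and n: "0 < n"
  shows "\<exists>e. eigenvalue M e"
proof -
  interpret of_real_hom: field_hom complex_of_real by unfold_locales auto
  define CM where "CM = map_mat complex_of_real M"
  have CM: "CM \<in> carrier_mat n n" using M by (simp add: CM_def)
  obtain l where l: "eigenvalue CM l"
    using spectrum_non_empty[OF CM n] by (auto simp: spectrum_def)
  then obtain v where v: "v \<in> carrier_vec n" "v \<noteq> 0\<^sub>v n" "CM *\<^sub>v v = l \<cdot>\<^sub>v v"
    using CM by (auto simp: eigenvalue_def eigenvector_def)
  have CMt: "transpose_mat CM = CM" using sym by (simp add: CM_def map_mat_transpose)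
  have conj: "CM *\<^sub>v conjugate v = conjugate (CM *\<^sub>v v)"
    using CM v(1) M by (intro eq_vecI) (auto simp: CM_def scalar_prod_def)
  \<comment> \<open>The Hermitian argument: moving the real symmetric matrix across the product
    turns \<open>l\<close> into its conjugate, and the squared norm of \<open>v\<close> is
    nonzero.\<close>
  have "l * (v \<bullet>c v) = (CM *\<^sub>v v) \<bullet>c v" using v by simp
  also have "\<dots> = v \<bullet> (CM *\<^sub>v conjugate v)"
    using transpose_vec_mult_scalar[OF CM, of "conjugate v" v] v CM CMt by simp
  also have "\<dots> = cnj l * (v \<bullet>c v)" unfolding conj v(3) using v by (simp add: conjugate_smult_vec)
  finally have "l = cnj l" using v by (auto simp: conjugate_square_eq_0_vec)
  then have "l = of_real (Re l)" by (simp add: complex_eq_iff)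
  moreover have "poly (map_poly complex_of_real (char_poly M)) l = 0"
    using l eigenvalue_root_char_poly[OF CM] unfolding CM_def of_real_hom.char_poly_hom[OF M] by simp
  ultimately have "poly (map_poly complex_of_real (char_poly M)) (of_real (Re l)) = 0" by simp
  then have "poly (char_poly M) (Re l) = 0" by simp
  then show ?thesis using eigenvalue_root_char_poly[OF M] by blast
qed

text \<open>Extend \<open>v\<close> to a basis, orthogonalize with \<open>v\<close> in first place,
  and normalize. The scalar \<open>c\<close> may stay unspecified, since every multiple of an
  eigenvector satisfies the same eigenvalue equation.\<close>

lemma orthogonal_completion:
  fixes v :: "real vec"
  assumes v: "v \<in> carrier_vec n" and v0: "v \<noteq> 0\<^sub>v n"
  shows "\<exists>U \<in> carrier_mat n n. U * transpose_mat U = 1\<^sub>m n \<and> (\<exists>c. row U 0 = c \<cdot>\<^sub>v v)"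
proof -
  interpret cof_vec_space n "TYPE(real)" .
  note b = basis_completion[OF v v0]
  define ws where "ws = gram_schmidt n (basis_completion v)"
  note gs = gram_schmidt_result[OF b(2,4,5) ws_def]
  have n: "n \<noteq> 0" using v v0 by auto
  have len: "length ws = n" using gs(4) b(6) by simp
  obtain vs where "basis_completion v = v # vs"
    using b(6,7) n by (cases "basis_completion v") auto
  then have hd: "ws ! 0 = v"
    using gram_schmidt_hd[OF v, of vs] len n by (metis hd_conv_nth length_0_conv ws_def)
  have wc: "ws ! i \<in> carrier_vec n" if "i < n" for i using gs(3) len that by auto
  \<comment> \<open>The equivalence also says that each vector has a nonzero product with itself,
    which permits the normalization by \<open>c\<close>.\<close>
  have orth: "ws ! i \<bullet> ws ! j = 0 \<longleftrightarrow> i \<noteq> j" if "i < n" "j < n" for i j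
    using corthogonalD[OF gs(2), of i j] that len by simp
  have pos: "0 < ws ! i \<bullet> ws ! i" if "i < n" for i
    using orth[OF that that] by (simp add: scalar_prod_def less_le sum_nonneg)
  define c where "c i = 1 / sqrt (ws ! i \<bullet> ws ! i)" for i
  define U where "U = mat_of_rows n (map (\<lambda>i. c i \<cdot>\<^sub>v ws ! i) [0..<n])"
  have U: "U \<in> carrier_mat n n" by (simp add: U_def mat_of_rows_def)
  have row: "row U i = c i \<cdot>\<^sub>v ws ! i" if "i < n" for i
    unfolding U_def using that wc by (subst mat_of_rows_row) auto
  have "c i * (c i * (ws ! i \<bullet> ws ! i)) = 1" if "i < n" for i
    using pos[OF that] by (simp add: c_def field_simps)
  moreover have "row U i \<bullet> row U j = c i * (c j * (ws ! i \<bullet> ws ! j))" if "i < n" "j < n" for i j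
    using that wc by (simp add: row scalar_prod_smult_distrib[of _ n] smult_scalar_prod_distrib[of _ n])
  ultimately have "row U i \<bullet> row U j = (if i = j then 1 else 0)" if "i < n" "j < n" for i j
    using orth[OF that] that by simp
  then have "U * transpose_mat U = 1\<^sub>m n"
    using U by (intro eq_matI) simp_all
  then show ?thesis using U row[of 0] n hd by auto
qed

text \<open>Induction on the dimension. Rotating an eigenvector into the first coordinate clears the
  rest of the first column, and by symmetry of the first row; the remaining block is symmetric of
  size one less.\<close>

lemma symmetric_orthogonal_diagonalization:
  fixes M :: "real mat"
  assumes "M \<in> carrier_mat n n" "transpose_mat M = M"
  shows "\<exists>U \<in> carrier_mat n n. U * transpose_mat U = 1\<^sub>m n \<and> diagonal_mat (U * M * transpose_mat U)"
  using assms
proof (induction n arbitrary: M)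
  case 0
  then show ?case by (intro bexI[of _ "1\<^sub>m 0"]) (auto simp: diagonal_mat_def)
next
  case (Suc m)
  let ?n = "Suc m"
  note M = Suc.prems(1) and sym = Suc.prems(2)
  obtain e where "eigenvalue M e" using symmetric_eigenvalue_exists[OF M sym] by auto
  then obtain v where v: "v \<in> carrier_vec ?n" "v \<noteq> 0\<^sub>v ?n" "M *\<^sub>v v = e \<cdot>\<^sub>v v"
    using M by (auto simp: eigenvalue_def eigenvector_def)
  obtain W c where W: "W \<in> carrier_mat ?n ?n" and WW: "W * transpose_mat W = 1\<^sub>m ?n"
    and row: "row W 0 = c \<cdot>\<^sub>v v"
    using orthogonal_completion[OF v(1,2)] by auto
  define N where "N = W * M * transpose_mat W"
  have N: "N \<in> carrier_mat ?n ?n" using W M by (simp add: N_def)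
  have Nt: "transpose_mat N = N" unfolding N_def by (rule symmetric_congruence[OF M sym W])
  have "col N 0 = W * M *\<^sub>v row W 0"
    using W M by (simp add: N_def col_mult2[of _ ?n ?n _ ?n] del: assoc_mult_mat)
  also have "\<dots> = W *\<^sub>v (M *\<^sub>v row W 0)"
    by (rule assoc_mult_mat_vec[OF W M carrier_vecI]) (use W in simp)
  also have "\<dots> = e \<cdot>\<^sub>v (W *\<^sub>v row W 0)"
    using W M v by (simp add: row mult_mat_vec[of _ ?n ?n] smult_smult_assoc mult.commute)
  \<comment> \<open>The product is the first column of \<open>W W\<^sup>T\<close>, hence of the
    identity.\<close>
  also have "W *\<^sub>v row W 0 = col (1\<^sub>m ?n) 0"
    using W by (simp add: mult_mat_vec_def flip: WW)
  finally have col: "col N 0 = e \<cdot>\<^sub>v col (1\<^sub>m ?n) 0" .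
  have N0: "N $$ (i, 0) = (if i = 0 then e else 0)" if "i < ?n" for i
    using arg_cong[OF col, of "\<lambda>w. w $ i"] N that by auto
  have N0': "N $$ (0, i) = (if i = 0 then e else 0)" if "i < ?n" for i
    using N0[OF that] Nt N that index_transpose_mat(1)[of 0 N i] by auto
  define N' where "N' = mat m m (\<lambda>(i, j). N $$ (Suc i, Suc j))"
  have N': "N' \<in> carrier_mat m m" by (simp add: N'_def)
  have Nb: "N = four_block_mat (e \<cdot>\<^sub>m 1\<^sub>m 1) (0\<^sub>m 1 m) (0\<^sub>m m 1) N'"
    using N by (intro eq_matI) (auto simp: N'_def N0 N0')
  have "transpose_mat N' = N'"
  proof (rule eq_matI)
    fix i j assume "i < dim_row N'" "j < dim_col N'"
    then show "transpose_mat N' $$ (i, j) = N' $$ (i, j)"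
      using Nt N index_transpose_mat(1)[of "Suc i" N "Suc j"] by (simp add: N'_def)
  qed (simp_all add: N'_def)
  from Suc.IH[OF N' this] obtain V where V: "V \<in> carrier_mat m m" and VV: "V * transpose_mat V = 1\<^sub>m m"
    and D: "diagonal_mat (V * N' * transpose_mat V)" by auto
  \<comment> \<open>Extending \<open>V\<close> by a 1 in the corner fixes the eigenvector already
    split off, so \<open>Z W\<close> diagonalizes the whole matrix.\<close>
  define Z where "Z = four_block_mat (1\<^sub>m 1) (0\<^sub>m 1 m) (0\<^sub>m m 1) V"
  have Z: "Z \<in> carrier_mat ?n ?n" using V four_block_carrier_mat[of "1\<^sub>m 1" 1 1 V m m] by (simp add: Z_def)
  have Zt: "transpose_mat Z = four_block_mat (1\<^sub>m 1) (0\<^sub>m 1 m) (0\<^sub>m m 1) (transpose_mat V)"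
    using V by (simp add: Z_def transpose_four_block_mat[of _ 1 1 _ m _ m])
  have ZZ: "Z * transpose_mat Z = 1\<^sub>m ?n"
    unfolding Zt unfolding Z_def using V VV
    by (subst mult_four_block_mat[of _ 1 1 _ m _ m _ _ 1 _ m])
      (auto simp: right_mult_zero_mat[of _ m m] left_mult_zero_mat[of _ m m])
  have "Z * N * transpose_mat Z = four_block_mat (e \<cdot>\<^sub>m 1\<^sub>m 1) (0\<^sub>m 1 m) (0\<^sub>m m 1) (V * N' * transpose_mat V)"
    unfolding Zt unfolding Z_def Nb using V N'
    by (simp add: mult_four_block_mat[of _ 1 1 _ m _ m _ _ 1 _ m])
  then have ZD: "diagonal_mat (Z * N * transpose_mat Z)"
    using D V by (auto simp: diagonal_mat_def)
  have "(Z * W) * transpose_mat (Z * W) = Z * (W * transpose_mat W) * transpose_mat Z"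
    using Z W by (simp add: transpose_mult_dim mult_mat_assoc_dim)
  also have "\<dots> = 1\<^sub>m ?n" using Z by (simp add: WW ZZ)
  finally have 1: "(Z * W) * transpose_mat (Z * W) = 1\<^sub>m ?n" .
  have "(Z * W) * M * transpose_mat (Z * W) = Z * N * transpose_mat Z"
    using Z W M by (simp add: N_def transpose_mult_dim mult_mat_assoc_dim)
  then show ?case using 1 ZD Z W by (intro bexI[of _ "Z * W"]) auto
qed

text \<open>An orthogonal diagonalization becomes a singular value decomposition once the rows are
  permuted so that the eigenvalues, which are nonnegative here, descend.\<close>

lemma svd_exists:
  assumes A: "A \<in> pos_semidef_mats n"
  shows "\<exists>U \<Sigma>. is_svd n A U \<Sigma>"
proof -
  have Ac: "A \<in> carrier_mat n n" and At: "transpose_mat A = A"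
    using A by (auto simp: pos_semidef_mats_def)
  obtain V where V: "V \<in> carrier_mat n n" and VV: "V * transpose_mat V = 1\<^sub>m n"
    and D: "diagonal_mat (V * A * transpose_mat V)"
    using symmetric_orthogonal_diagonalization[OF Ac At] by auto
  define d where "d i = (V * A * transpose_mat V) $$ (i, i)" for i
  \<comment> \<open>Sorting is ascending, so negated keys give the descending order.\<close>
  define p where "p = sort_key (\<lambda>i. - d i) [0..<n]"
  have p: "length p = n" "distinct p" "set p = {..<n}"
    by (auto simp: p_def)
  have pn: "p ! i < n" if "i < n" for i using p that nth_mem[of i p] by auto
  have "sorted (map (\<lambda>i. - d i) p)" by (simp add: p_def)
  then have dec: "d (p ! j) \<le> d (p ! i)" if "i \<le> j" "j < n" for i j
    using that p(1) sorted_nth_mono[of "map (\<lambda>i. - d i) p" i j] by simp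
  define U where "U = mat n n (\<lambda>(i, j). V $$ (p ! i, j))"
  have U: "U \<in> carrier_mat n n" by (simp add: U_def)
  have row: "row U i = row V (p ! i)" if "i < n" for i
    using that V pn by (intro eq_vecI) (auto simp: U_def)
  have pi: "p ! i = p ! j \<longleftrightarrow> i = j" if "i < n" "j < n" for i j
    using p that by (simp add: nth_eq_iff_index_eq)
  \<comment> \<open>Each entry depends on two rows of \<open>X\<close> only, so permuting the rows
    of \<open>V\<close> permutes both indices of the diagonalized matrix.\<close>
  have entry: "(X * C * transpose_mat X) $$ (i, j) = row X i \<bullet> (C *\<^sub>v row X j)"
    if "X \<in> carrier_mat n n" "C \<in> carrier_mat n n" "i < n" "j < n" for X C i j
    using that by (simp add: mult_mat_assoc_dim mult_mat_vec_def)
  have UU: "U * transpose_mat U = 1\<^sub>m n"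
  proof (rule eq_matI)
    fix i j assume "i < dim_row (1\<^sub>m n :: real mat)" "j < dim_col (1\<^sub>m n :: real mat)"
    then have ij: "i < n" "j < n" by auto
    have "(U * transpose_mat U) $$ (i, j) = (V * transpose_mat V) $$ (p ! i, p ! j)"
      using ij U V pn by (simp add: row)
    then show "(U * transpose_mat U) $$ (i, j) = 1\<^sub>m n $$ (i, j)"
      using ij pn by (simp add: VV pi)
  qed (use U in auto)
  define \<Sigma> where "\<Sigma> = U * A * transpose_mat U"
  have S: "\<Sigma> \<in> carrier_mat n n" using U Ac by (simp add: \<Sigma>_def)
  have Sij: "\<Sigma> $$ (i, j) = (V * A * transpose_mat V) $$ (p ! i, p ! j)" if "i < n" "j < n" for i j
    using that U V Ac pn by (simp add: \<Sigma>_def entry row del: index_mult_mat assoc_mult_mat)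
  have "diagonal_mat \<Sigma>"
    using D S V pn by (auto simp: diagonal_mat_def Sij pi)
  moreover have "0 \<le> \<Sigma> $$ (i, i)" if "i < n" for i
    using pos_semidef_diag_nonneg[OF pos_semidef_congruence[OF A U] that] by (simp add: \<Sigma>_def)
  moreover have "\<Sigma> $$ (j, j) \<le> \<Sigma> $$ (i, i)" if "i \<le> j" "j < n" for i j
    using dec[OF that] that Sij[of i i] Sij[of j j] by (simp add: d_def)
  moreover have UtU: "transpose_mat U * U = 1\<^sub>m n"
    using mat_mult_left_right_inverse[OF U _ UU] U by simp
  moreover have "A = transpose_mat U * \<Sigma> * U"
  proof -
    have "transpose_mat U * \<Sigma> * U = (transpose_mat U * U) * A * (transpose_mat U * U)"
      unfolding \<Sigma>_def using U Ac by (simp add: mult_mat_assoc_dim)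
    then show ?thesis using Ac by (simp add: UtU)
  qed
  ultimately show ?thesis using U UU S unfolding is_svd_def by blast
qed

lemma is_svd_diagonal:
  assumes "is_svd n A U \<Sigma>"
  shows "U * A * transpose_mat U = \<Sigma>"
proof -
  have U: "U \<in> carrier_mat n n" "U * transpose_mat U = 1\<^sub>m n" and S: "\<Sigma> \<in> carrier_mat n n"
    and A: "A = transpose_mat U * \<Sigma> * U"
    using assms by (auto simp: is_svd_def)
  have "U * A * transpose_mat U = (U * transpose_mat U) * \<Sigma> * (U * transpose_mat U)"
    unfolding A using U(1) S by (simp add: mult_mat_assoc_dim)
  then show ?thesis using U S by simp
qed

section \<open>Existence and uniqueness of positive semidefinite square roots\<close>

lemma diagonal_mult_entry:
  fixes D X :: "'a :: semiring_0 mat"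
  assumes "D \<in> carrier_mat n n" "diagonal_mat D" "X \<in> carrier_mat n m" "i < n" "j < m"
  shows "(D * X) $$ (i, j) = D $$ (i, i) * X $$ (i, j)"
proof -
  have "(D * X) $$ (i, j) = (\<Sum>k<n. D $$ (i, k) * X $$ (k, j))"
    using assms by (simp add: scalar_prod_def atLeast0LessThan)
  also have "\<dots> = (\<Sum>k<n. if k = i then D $$ (i, i) * X $$ (i, j) else 0)"
    using assms by (intro sum.cong) (auto simp: diagonal_mat_def)
  finally show ?thesis using assms(4) by simp
qed

lemma mult_diagonal_entry:
  fixes D X :: "'a :: semiring_0 mat"
  assumes "D \<in> carrier_mat n n" "diagonal_mat D" "X \<in> carrier_mat m n" "i < m" "j < n"
  shows "(X * D) $$ (i, j) = X $$ (i, j) * D $$ (j, j)"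
proof -
  have "(X * D) $$ (i, j) = (\<Sum>k<n. X $$ (i, k) * D $$ (k, j))"
    using assms by (simp add: scalar_prod_def atLeast0LessThan)
  also have "\<dots> = (\<Sum>k<n. if k = j then X $$ (i, j) * D $$ (j, j) else 0)"
    using assms by (intro sum.cong) (auto simp: diagonal_mat_def)
  finally show ?thesis using assms(5) by simp
qed

lemma pos_semidef_sqrt_exists:
  assumes A: "A \<in> pos_semidef_mats n"
  shows "\<exists>X \<in> pos_semidef_mats n. X * X = A"
proof -
  obtain U \<Sigma> where svd: "is_svd n A U \<Sigma>" using svd_exists[OF A] by auto
  then have U: "U \<in> carrier_mat n n" "U * transpose_mat U = 1\<^sub>m n" and S: "\<Sigma> \<in> carrier_mat n n"
    "diagonal_mat \<Sigma>" "\<And>i. i < n \<Longrightarrow> 0 \<le> \<Sigma> $$ (i, i)" "A = transpose_mat U * \<Sigma> * U"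
    by (auto simp: is_svd_def)
  define D where "D r = mat n n (\<lambda>(i, j). if i = j then r (\<Sigma> $$ (i, i)) else 0)" for r :: "real \<Rightarrow> real"
  have D: "D r \<in> carrier_mat n n" "diagonal_mat (D r)" for r by (auto simp: D_def diagonal_mat_def)
  have Dt: "transpose_mat (D r) = D r" for r by (intro eq_matI) (auto simp: D_def)
  have DD: "(D r * D r) $$ (i, j) = (if i = j then (r (\<Sigma> $$ (i, i)))\<^sup>2 else 0)" if "i < n" "j < n" for r i j
    using that diagonal_mult_entry[OF D D(1) that, of r] by (simp add: D_def power2_eq_square)
  have sq: "D sqrt * D sqrt = \<Sigma>"
    using S(1-3) D(1)[of sqrt] by (intro eq_matI) (auto simp: DD diagonal_mat_def simp del: index_mult_mat(1))
  \<comment> \<open>Fourth roots of the eigenvalues exhibit \<open>D sqrt\<close> as a Gram matrix,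
    so its semidefiniteness needs no computation with the quadratic form.\<close>
  have "D (sqrt \<circ> sqrt) * D (sqrt \<circ> sqrt) = D sqrt"
    using S(3) D(1)[of "sqrt \<circ> sqrt"] D(1)[of sqrt]
    by (intro eq_matI) (auto simp: DD D_def[of sqrt] simp del: index_mult_mat(1))
  then have "D sqrt \<in> pos_semidef_mats n"
    using gram_pos_semidef[of "D (sqrt \<circ> sqrt)" n n] D(1) by (simp add: Dt)
  then have "transpose_mat U * D sqrt * U \<in> pos_semidef_mats n"
    using pos_semidef_congruence[of "D sqrt" n "transpose_mat U" n] U by simp
  moreover have "transpose_mat U * D sqrt * U * (transpose_mat U * D sqrt * U) =
      transpose_mat U * (D sqrt * (U * transpose_mat U) * D sqrt) * U"
    using U(1) D(1)[of sqrt] by (simp add: mult_mat_assoc_dim)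
  ultimately show ?thesis using U D(1)[of sqrt] by (intro bexI[of _ "transpose_mat U * D sqrt * U"]) (auto simp: sq S(4))
qed

text \<open>With \<open>X = V\<^sup>T D V\<close> and \<open>Y = W\<^sup>T E W\<close>, each entry \<open>g\<close> of \<open>V W\<^sup>T\<close> satisfies
  \<open>d\<^sup>2 g = g e\<^sup>2\<close> for the corresponding eigenvalues \<open>d, e \<ge> 0\<close>, whence \<open>d g = g e\<close>.\<close>

lemma pos_semidef_sqrt_unique:
  assumes X: "X \<in> pos_semidef_mats n" and Y: "Y \<in> pos_semidef_mats n" and eq: "X * X = Y * Y"
  shows "X = Y"
proof -
  obtain V D where "is_svd n X V D" using svd_exists[OF X] by auto
  then have V: "V \<in> carrier_mat n n" "V * transpose_mat V = 1\<^sub>m n" "transpose_mat V * V = 1\<^sub>m n"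
    and D: "D \<in> carrier_mat n n" "diagonal_mat D" "\<And>i. i < n \<Longrightarrow> 0 \<le> D $$ (i, i)"
    and XD: "X = transpose_mat V * D * V"
    by (auto simp: is_svd_def)
  obtain W E where "is_svd n Y W E" using svd_exists[OF Y] by auto
  then have W: "W \<in> carrier_mat n n" "W * transpose_mat W = 1\<^sub>m n" "transpose_mat W * W = 1\<^sub>m n"
    and E: "E \<in> carrier_mat n n" "diagonal_mat E" "\<And>i. i < n \<Longrightarrow> 0 \<le> E $$ (i, i)"
    and YE: "Y = transpose_mat W * E * W"
    by (auto simp: is_svd_def)
  have XYc: "X \<in> carrier_mat n n" "Y \<in> carrier_mat n n" using X Y by (auto simp: pos_semidef_mats_def)
  have VX: "V * X = D * V"
  proof -
    have "V * X = (V * transpose_mat V) * D * V" unfolding XD using V(1) D(1) by (simp add: mult_mat_assoc_dim)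
    then show ?thesis using V D by simp
  qed
  have YW: "Y * transpose_mat W = transpose_mat W * E"
  proof -
    have "Y * transpose_mat W = transpose_mat W * E * (W * transpose_mat W)"
      unfolding YE using W(1) E(1) by (simp add: mult_mat_assoc_dim)
    then show ?thesis using W E by simp
  qed
  define G where "G = V * transpose_mat W"
  have G: "G \<in> carrier_mat n n" using V W by (simp add: G_def)
  have "D * (D * G) = (D * (D * V)) * transpose_mat W"
    using V W D by (simp add: G_def mult_mat_assoc_dim)
  also have "D * (D * V) = V * (X * X)"
  proof -
    have "V * (X * X) = V * X * X" using V XYc by (simp add: mult_mat_assoc_dim)
    also have "\<dots> = D * (D * V)" using V D XYc by (simp add: VX mult_mat_assoc_dim)
    finally show ?thesis by simp
  qed
  also have "V * (X * X) * transpose_mat W = V * (Y * (Y * transpose_mat W))"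
    using V W XYc unfolding eq by (simp add: mult_mat_assoc_dim)
  also have "\<dots> = V * (Y * transpose_mat W * E)"
  proof -
    have "Y * (transpose_mat W * E) = Y * transpose_mat W * E"
      using W XYc E by (simp add: mult_mat_assoc_dim)
    then show ?thesis by (simp add: YW)
  qed
  also have "\<dots> = G * E * E"
    unfolding YW using V W E by (simp add: G_def mult_mat_assoc_dim)
  finally have DDG: "D * (D * G) = G * E * E" .
  have DG: "D * G = G * E"
  proof (rule eq_matI)
    fix i j assume "i < dim_row (G * E)" "j < dim_col (G * E)"
    then have ij: "i < n" "j < n" using G E by auto
    note entries = diagonal_mult_entry[OF D(1,2)] mult_diagonal_entry[OF E(1,2)]
    have "D $$ (i, i) * (D $$ (i, i) * G $$ (i, j)) = G $$ (i, j) * E $$ (j, j) * E $$ (j, j)"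
      using arg_cong[OF DDG, of "\<lambda>M. M $$ (i, j)"] ij G D(1) E(1)
      by (simp add: entries[of _ n] del: index_mult_mat(1) assoc_mult_mat)
    then have "G $$ (i, j) = 0 \<or> (D $$ (i, i))\<^sup>2 = (E $$ (j, j))\<^sup>2"
      by (simp add: power2_eq_square)
    then have "G $$ (i, j) = 0 \<or> D $$ (i, i) = E $$ (j, j)"
      using D(3)[OF ij(1)] E(3)[OF ij(2)] by auto
    then show "(D * G) $$ (i, j) = (G * E) $$ (i, j)"
      using ij G D(1) E(1) by (auto simp add: entries[of _ n] simp del: index_mult_mat(1))
  qed (use G D E in auto)
  \<comment> \<open>This is \<open>D G = G E\<close> in the original terms; the orthogonal factors
    on both sides then cancel.\<close>
  have "V * X * transpose_mat W = V * Y * transpose_mat W"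
    using DG V W D E XYc unfolding G_def by (simp add: VX YW mult_mat_assoc_dim)
  then have "transpose_mat V * (V * X * transpose_mat W) * W = transpose_mat V * (V * Y * transpose_mat W) * W"
    by simp
  moreover have "transpose_mat V * (V * Z * transpose_mat W) * W = Z" if "Z \<in> carrier_mat n n" for Z
  proof -
    have "transpose_mat V * (V * Z * transpose_mat W) * W = (transpose_mat V * V) * Z * (transpose_mat W * W)"
      using V(1) W(1) that by (simp add: mult_mat_assoc_dim)
    then show ?thesis using V W that by simp
  qed
  ultimately show ?thesis using XYc by simp
qed

text \<open>Existence and uniqueness together give the definite description in
  \<open>sqrt_mat\<close> its meaning.\<close>

lemma sqrt_mat_pos_semidef:
  assumes A: "A \<in> pos_semidef_mats n"
  shows "sqrt_mat A \<in> pos_semidef_mats n" "sqrt_mat A * sqrt_mat A = A"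
proof -
  have "dim_row A = n" using A by (auto simp: pos_semidef_mats_def)
  moreover obtain X where "X \<in> pos_semidef_mats n" "X * X = A"
    using pos_semidef_sqrt_exists[OF A] by auto
  ultimately have "\<exists>!X. X \<in> pos_semidef_mats (dim_row A) \<and> X * X = A"
    using pos_semidef_sqrt_unique by metis
  from theI'[OF this] show "sqrt_mat A \<in> pos_semidef_mats n" "sqrt_mat A * sqrt_mat A = A"
    unfolding sqrt_mat_def using \<open>dim_row A = n\<close> by auto
qed

section \<open>Block structure and rank\<close>

text \<open>For \<open>r \<le> m\<close> this is the inclusion of the first \<open>r\<close>
  coordinates. It turns the selection of leading rows or columns into a matrix product, so that
  index arguments become algebra.\<close>

definition incl_mat :: "nat \<Rightarrow> nat \<Rightarrow> real mat" where
  "incl_mat m r = mat m r (\<lambda>(i, j). if i = j then 1 else 0)"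

lemma incl_mat_carrier [simp]: "incl_mat m r \<in> carrier_mat m r"
  "dim_row (incl_mat m r) = m" "dim_col (incl_mat m r) = r"
  by (auto simp: incl_mat_def)

lemma mult_incl_mat_index:
  assumes "X \<in> carrier_mat k m" "i < k" "j < r" "r \<le> m"
  shows "(X * incl_mat m r) $$ (i, j) = X $$ (i, j)"
proof -
  have "(X * incl_mat m r) $$ (i, j) = (\<Sum>l<m. if l = j then X $$ (i, j) else 0)"
    using assms by (simp add: incl_mat_def scalar_prod_def atLeast0LessThan if_distrib cong: if_cong)
  then show ?thesis using assms by simp
qed

lemma transpose_incl_mat_mult_index:
  assumes "X \<in> carrier_mat m k" "i < r" "j < k" "r \<le> m"
  shows "(transpose_mat (incl_mat m r) * X) $$ (i, j) = X $$ (i, j)"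
proof -
  have "(transpose_mat (incl_mat m r) * X) $$ (i, j) = (transpose_mat X * incl_mat m r) $$ (j, i)"
    using assms arg_cong[OF transpose_mult_dim[of "transpose_mat X" "incl_mat m r"], of "\<lambda>M. M $$ (i, j)"]
    by (simp del: index_mult_mat(1))
  then show ?thesis using assms mult_incl_mat_index[of "transpose_mat X" k m j i r] by simp
qed

lemma mult_transpose_incl_mat_index:
  assumes "X \<in> carrier_mat k r" "i < k" "j < m"
  shows "(X * transpose_mat (incl_mat m r)) $$ (i, j) = (if j < r then X $$ (i, j) else 0)"
proof -
  have "(X * transpose_mat (incl_mat m r)) $$ (i, j) = (\<Sum>l<r. X $$ (i, l) * (if j = l then 1 else 0))"
    using assms by (simp add: incl_mat_def scalar_prod_def atLeast0LessThan)
  also have "\<dots> = (\<Sum>l<r. if j = l then X $$ (i, l) else 0)" by (intro sum.cong) auto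
  finally show ?thesis by simp
qed

lemma transpose_incl_mat_mult_incl_mat:
  assumes "r \<le> m"
  shows "transpose_mat (incl_mat m r) * incl_mat m r = 1\<^sub>m r"
  using assms transpose_incl_mat_mult_index[of "incl_mat m r" m r]
  by (intro eq_matI) (auto simp: incl_mat_def simp del: index_mult_mat(1))

section \<open>Stacked rows and submatrices\<close>

lemma append_rows_index:
  assumes "X \<in> carrier_mat a c" "Y \<in> carrier_mat b c" "i < a + b" "j < c"
  shows "(X @\<^sub>r Y) $$ (i, j) = (if i < a then X $$ (i, j) else Y $$ (i - a, j))"
  using assms by (simp add: append_rows_def)

lemma append_rows_mult:
  fixes X Y Z :: "'a :: comm_semiring_0 mat"
  assumes "X \<in> carrier_mat a c" "Y \<in> carrier_mat b c" "Z \<in> carrier_mat c d"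
  shows "(X @\<^sub>r Y) * Z = X * Z @\<^sub>r Y * Z"
proof (rule eq_matI)
  fix i j assume "i < dim_row (X * Z @\<^sub>r Y * Z)" "j < dim_col (X * Z @\<^sub>r Y * Z)"
  then have ij: "i < a + b" "j < d" using assms by (auto simp: append_rows_def)
  have "row (X @\<^sub>r Y) i = (if i < a then row X i else row Y (i - a))"
    using assms ij by (intro eq_vecI) (auto simp: append_rows_def)
  then show "((X @\<^sub>r Y) * Z) $$ (i, j) = (X * Z @\<^sub>r Y * Z) $$ (i, j)"
    using assms ij by (subst append_rows_index[of _ a d _ b]) (auto simp: append_rows_def)
qed (use assms in \<open>auto simp: append_rows_def\<close>)

text \<open>\<open>pick\<close> enumerates a set in increasing order, so an element's position is
  the number of smaller elements in the set. For an initial segment that number is the element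
  itself.\<close>

lemma pick_lessThan:
  assumes "i < r"
  shows "pick {..<r} i = i"
proof -
  have "{a \<in> {..<r}. a < i} = {..<i}" using assms by auto
  then show ?thesis using pick_card_in_set[of i "{..<r}"] assms by simp
qed

lemma pick_atLeastLessThan:
  assumes "i < m - r"
  shows "pick {r..<m} i = r + i"
proof -
  have "{a \<in> {r..<m}. a < r + i} = {r..<r + i}" using assms by auto
  then show ?thesis using pick_card_in_set[of "r + i" "{r..<m}"] assms by simp
qed

lemma leading_submatrix_carrier:
  assumes "A \<in> carrier_mat m m" "r \<le> m"
  shows "leading_submatrix A r \<in> carrier_mat r r"
    "i < r \<Longrightarrow> j < r \<Longrightarrow> leading_submatrix A r $$ (i, j) = A $$ (i, j)"
proof -
  have "{i. i < m \<and> i \<in> {..<r}} = {..<r}" using assms by auto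
  then have *: "card {i. i < m \<and> i \<in> {..<r}} = r" by simp
  show "leading_submatrix A r \<in> carrier_mat r r"
    using assms * unfolding leading_submatrix_def by (intro carrier_matI) (simp_all add: dim_submatrix)
  show "i < r \<Longrightarrow> j < r \<Longrightarrow> leading_submatrix A r $$ (i, j) = A $$ (i, j)"
    using assms * unfolding leading_submatrix_def by (simp add: submatrix_index pick_lessThan)
qed

lemma upper_right_submatrix:
  assumes "A \<in> carrier_mat m m" "r \<le> m"
  shows "submatrix A {..<r} {r..<m} \<in> carrier_mat r (m - r)"
    "i < r \<Longrightarrow> j < m - r \<Longrightarrow> submatrix A {..<r} {r..<m} $$ (i, j) = A $$ (i, r + j)"
proof -
  have "{i. i < m \<and> i \<in> {..<r}} = {..<r}" "{i. i < m \<and> i \<in> {r..<m}} = {r..<m}" using assms by auto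
  then have *: "card {i. i < m \<and> i \<in> {..<r}} = r" "card {i. i < m \<and> i \<in> {r..<m}} = m - r" by simp_all
  show "submatrix A {..<r} {r..<m} \<in> carrier_mat r (m - r)"
    using assms * by (intro carrier_matI) (simp_all add: dim_submatrix)
  show "i < r \<Longrightarrow> j < m - r \<Longrightarrow> submatrix A {..<r} {r..<m} $$ (i, j) = A $$ (i, r + j)"
    using assms * by (simp add: submatrix_index pick_lessThan pick_atLeastLessThan)
qed

text \<open>Written as a congruence, the leading block inherits positive definiteness from
  \<open>A\<close> and can be absorbed into products with the inclusion.\<close>

lemma leading_submatrix_eq:
  assumes "A \<in> carrier_mat m m" "r \<le> m"
  shows "leading_submatrix A r = transpose_mat (incl_mat m r) * A * incl_mat m r"
proof (rule eq_matI)
  fix i j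
  assume "i < dim_row (transpose_mat (incl_mat m r) * A * incl_mat m r)"
    "j < dim_col (transpose_mat (incl_mat m r) * A * incl_mat m r)"
  then have ij: "i < r" "j < r" by auto
  have "(transpose_mat (incl_mat m r) * A * incl_mat m r) $$ (i, j) = (transpose_mat (incl_mat m r) * A) $$ (i, j)"
    using ij assms by (intro mult_incl_mat_index[of _ r]) auto
  also have "\<dots> = A $$ (i, j)"
    using ij assms by (intro transpose_incl_mat_mult_index[of _ _ m]) auto
  finally show "leading_submatrix A r $$ (i, j) = (transpose_mat (incl_mat m r) * A * incl_mat m r) $$ (i, j)"
    using leading_submatrix_carrier(2)[OF assms ij] by simp
qed (use leading_submatrix_carrier(1)[OF assms] in auto)

lemma pos_def_leading_submatrix:
  assumes A: "A \<in> pos_def_mats m" and r: "r \<le> m"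
  shows "leading_submatrix A r \<in> pos_def_mats r"
proof -
  have "A \<in> carrier_mat m m" using A by (simp add: pos_def_mats_def)
  then show ?thesis
    using pos_def_congruence[OF A, of "transpose_mat (incl_mat m r)" r "incl_mat m r"]
      transpose_incl_mat_mult_incl_mat[OF r] leading_submatrix_eq[of A m r] r by simp
qed

section \<open>Rank from a full-rank factorization\<close>

lemma (in vec_space) cols_mult_in_span:
  assumes X: "X \<in> carrier_mat n a" and Y: "Y \<in> carrier_mat a b"
  shows "set (cols (X * Y)) \<subseteq> span (set (cols X))"
proof
  have c: "set (cols X) \<subseteq> carrier_vec n" using X cols_dim by blast
  fix w assume "w \<in> set (cols (X * Y))"
  then obtain j where j: "j < b" "w = col (X * Y) j"
    using X Y by (auto simp: cols_def)
  have "w = mat_of_cols n (cols X) *\<^sub>v vec (length (cols X)) (\<lambda>i. col Y j $ i)"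
    using X Y j by (intro eq_vecI) (auto simp: scalar_prod_def)
  also have "\<dots> = lincomb_list (\<lambda>i. col Y j $ i) (cols X)"
    using c by (subst lincomb_list_as_mat_mult) auto
  finally have "w \<in> span_list (cols X)" by (auto simp: span_list_def)
  then show "w \<in> span (set (cols X))" using span_list_as_span[OF c] by simp
qed

text \<open>\<open>B\<close> and \<open>E\<close> are each the other times a matrix, so they share
  their column space; the left inverse \<open>F\<close> makes the \<open>p\<close> columns of
  \<open>E\<close> independent.\<close>

lemma rank_full_rank_factor:
  fixes B E C G F :: "'a :: field mat"
  assumes B: "B \<in> carrier_mat m n" and E: "E \<in> carrier_mat m p" and C: "C \<in> carrier_mat p n"
    and G: "G \<in> carrier_mat n p" and F: "F \<in> carrier_mat p m"
    and BE: "B = E * C" and EB: "E = B * G" and FE: "F * E = 1\<^sub>m p"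
  shows "vec_space.rank m B = p"
proof -
  interpret vec_space "TYPE('a)" m .
  have Ec: "set (cols E) \<subseteq> carrier_vec m" and Bc: "set (cols B) \<subseteq> carrier_vec m"
    using E B cols_dim by blast+
  have sub1: "span (set (cols B)) \<subseteq> span (set (cols E))"
    using span_subsetI[OF Ec cols_mult_in_span[OF E C]] BE by simp
  have sub2: "span (set (cols E)) \<subseteq> span (set (cols B))"
    using span_subsetI[OF Bc cols_mult_in_span[OF B G]] EB by simp
  from sub1 sub2 have "rank B = rank E" by (simp add: rank_def antisym)
  also have "rank E = p"
  proof (rule lin_indpt_full_rank[OF E])
    have FEv: "F *\<^sub>v (E *\<^sub>v v) = v" if "v \<in> carrier_vec p" for v
      using that FE assoc_mult_mat_vec[OF F E that] by simp
    \<comment> \<open>Independence concerns the set of columns, in which repetitions vanish, so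
      distinctness is shown separately: \<open>F\<close> sends the columns to distinct unit
      vectors.\<close>
    show dist: "distinct (cols E)"
    proof (subst distinct_conv_nth, intro allI impI)
      fix i j assume ij: "i < length (cols E)" "j < length (cols E)" "i \<noteq> j"
      then have "col (1\<^sub>m p) i \<noteq> (col (1\<^sub>m p) j :: 'a vec)" using E by (auto simp: unit_vec_eq)
      moreover have "col (1\<^sub>m p) k = F *\<^sub>v col E k" if "k < p" for k
        unfolding FE[symmetric] using F E that by (simp add: mult_mat_vec_def)
      ultimately show "cols E ! i \<noteq> cols E ! j" using ij E by auto
    qed
    show "lin_indpt (set (cols E))"
    proof
      assume "lin_dep (set (cols E))"
      then obtain v where v: "v \<in> carrier_vec p" "v \<noteq> 0\<^sub>v p" "E *\<^sub>v v = 0\<^sub>v m"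
        using lin_depE[OF E _ dist] by blast
      then show False using FEv[OF v(1)] mult_mat_zero_vec[OF F] by simp
    qed
  qed
  finally show ?thesis .
qed

section \<open>The decomposition\<close>

lemma gram_of_transpose_mult:
  fixes V U :: "real mat"
  assumes "V \<in> carrier_mat m k" "U \<in> carrier_mat m m"
  shows "transpose_mat (transpose_mat V * U) * (transpose_mat V * U) = transpose_mat U * (V * transpose_mat V) * U"
  using assms by (simp add: transpose_mult_dim mult_mat_assoc_dim)

text \<open>A left kernel is the kernel of the transpose, and multiplying the transpose on the left
  by \<open>Z\<close> can only enlarge that kernel.\<close>

lemma left_kernel_subset:
  assumes X: "X \<in> carrier_mat m k" and Y: "Y \<in> carrier_mat m l" and Z: "Z \<in> carrier_mat k l"
    and eq: "transpose_mat X = Z * transpose_mat Y"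
  shows "left_kernel Y \<subseteq> left_kernel X"
  unfolding left_kernel_def eq
  using mat_kernel_mult_subset[of "transpose_mat Y" l m Z k] Y Z by simp

section \<open>The closed forms in the rotated basis\<close>

context
  fixes m r :: nat and U T A L J Y K :: "real mat"
  assumes T: "T \<in> pos_def_mats m" and U: "U \<in> carrier_mat m m"
    and UtU: "transpose_mat U * U = 1\<^sub>m m" and UUt: "U * transpose_mat U = 1\<^sub>m m" and r: "r \<le> m"
  defines "A \<equiv> U * T * transpose_mat U" and "L \<equiv> L_mat m r U T" and "J \<equiv> incl_mat m r"
    and "Y \<equiv> 1\<^sub>m r @\<^sub>r L"
  defines "K \<equiv> Y * leading_submatrix A r * transpose_mat Y"
begin

private lemma A_pos_def: "A \<in> pos_def_mats m"
  using pos_def_congruence[OF T U _ UUt] U by (simp add: A_def)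

private lemma A_carrier: "A \<in> carrier_mat m m" and A_sym: "transpose_mat A = A"
  using A_pos_def by (auto simp: pos_def_mats_def)

private lemmas A1_pos_def = pos_def_leading_submatrix[OF A_pos_def r]

private lemma A1_eq: "leading_submatrix A r = transpose_mat J * A * J"
  unfolding J_def by (rule leading_submatrix_eq[OF A_carrier r])

private lemma A1_carrier: "leading_submatrix A r \<in> carrier_mat r r"
  using A1_pos_def by (simp add: pos_def_mats_def)

private lemma L_eq: "L = transpose_mat (submatrix A {..<r} {r..<m}) * inv_mat (leading_submatrix A r)"
  by (simp add: L_def L_mat_def A_def Let_def)

private lemma L_carrier: "L \<in> carrier_mat (m - r) r"
  unfolding L_eq using upper_right_submatrix(1)[OF A_carrier r] pos_def_inv_mat(1)[OF A1_pos_def] by simp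

private lemma J_carrier: "J \<in> carrier_mat m r"
  by (simp add: J_def)

private lemma Y_carrier: "Y \<in> carrier_mat m r"
  using carrier_append_rows[OF one_carrier_mat[of r] L_carrier] r by (simp add: Y_def)

text \<open>\<open>L\<close> is built so that \<open>L A\<^sub>1\<close> is the transposed upper
  right block, which by symmetry of \<open>A\<close> is the lower left one. Stacked under
  \<open>A\<^sub>1\<close> it gives the first \<open>r\<close> columns of \<open>A\<close>.\<close>

private lemma Y_mult_A1: "Y * leading_submatrix A r = A * J"
proof -
  let ?A2 = "submatrix A {..<r} {r..<m}"
  note A2 = upper_right_submatrix[OF A_carrier r]
  have "L * leading_submatrix A r = transpose_mat ?A2"
    unfolding L_eq using A2(1) pos_def_inv_mat[OF A1_pos_def] A1_carrier
    by (simp add: mult_mat_assoc_dim)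
  then have YA: "Y * leading_submatrix A r = leading_submatrix A r @\<^sub>r transpose_mat ?A2"
    unfolding Y_def using append_rows_mult[OF one_carrier_mat L_carrier A1_carrier] A1_carrier by simp
  show ?thesis
    unfolding YA
  proof (rule eq_matI)
    fix i j assume "i < dim_row (A * J)" "j < dim_col (A * J)"
    then have ij: "i < m" "j < r" using A_carrier J_carrier by auto
    have "A $$ (i, j) = A $$ (j, i)"
      using ij r A_carrier A_sym index_transpose_mat(1)[of i A j] by simp
    then show "(leading_submatrix A r @\<^sub>r transpose_mat ?A2) $$ (i, j) = (A * J) $$ (i, j)"
      using ij r A_carrier A2 leading_submatrix_carrier[OF A_carrier r]
      by (simp add: append_rows_index[OF A1_carrier, of "transpose_mat ?A2" "m - r"]
          mult_incl_mat_index[OF A_carrier] J_def del: index_mult_mat(1))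
  qed (use A1_carrier A2(1) A_carrier J_carrier r in \<open>auto simp: append_rows_def\<close>)
qed

private lemma A1_mult_Yt: "leading_submatrix A r * transpose_mat Y = transpose_mat J * A"
proof -
  have "transpose_mat (leading_submatrix A r) = leading_submatrix A r"
    using A1_pos_def by (simp add: pos_def_mats_def)
  then show ?thesis
    using arg_cong[OF Y_mult_A1, of transpose_mat] A_carrier J_carrier Y_carrier A1_carrier
    by (simp add: transpose_mult_dim A_sym)
qed

private lemma K_carrier: "K \<in> carrier_mat m m"
  unfolding K_def using Y_carrier A1_carrier by simp

private lemma K_eq: "K = Y * (transpose_mat J * A)" "K = A * J * transpose_mat Y"
  unfolding K_def using Y_carrier A1_carrier
  by (simp_all add: mult_mat_assoc_dim Y_mult_A1 A1_mult_Yt del: assoc_mult_mat) (simp add: A1_mult_Yt[symmetric] Y_mult_A1[symmetric] mult_mat_assoc_dim)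

text \<open>\<open>K J = Y (J\<^sup>T A J) = Y A\<^sub>1\<close>. Consequently \<open>A - K\<close>
  annihilates the range of \<open>J\<close>, which drives both the Schur complement identity and the
  second summand.\<close>

private lemma K_mult_J: "K * J = A * J"
proof -
  have "K * J = Y * (transpose_mat J * A * J)"
    unfolding K_eq(1) using Y_carrier J_carrier A_carrier by (simp add: mult_mat_assoc_dim)
  then show ?thesis by (simp add: Y_mult_A1 flip: A1_eq)
qed

private lemma K_sym: "transpose_mat K = K"
  unfolding K_def using A1_pos_def
  by (intro symmetric_congruence[OF A1_carrier _ Y_carrier]) (simp add: pos_def_mats_def)

private lemma gram_T_ker_factor:
  "transpose_mat (T_ker_factor m r U T) * T_ker_factor m r U T = transpose_mat U * K * U"
proof -
  let ?Q = "sqrt_mat (leading_submatrix A r)"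
  note psd = sqrt_mat_pos_semidef[OF pos_def_imp_pos_semidef[OF A1_pos_def]]
  have Q: "?Q \<in> carrier_mat r r" "transpose_mat ?Q = ?Q"
    using psd(1) by (auto simp: pos_semidef_mats_def)
  have "T_ker_factor m r U T = transpose_mat (?Q @\<^sub>r L * ?Q) * U"
    by (simp add: T_ker_factor_def Let_def A_def L_def)
  \<comment> \<open>Once the square root is pulled out of the stacked blocks, the Gram matrix
    contains it only as \<open>?Q * ?Q\<close>, which is the leading block.\<close>
  also have "?Q @\<^sub>r L * ?Q = Y * ?Q"
    using append_rows_mult[OF one_carrier_mat L_carrier Q(1)] Q(1) by (simp add: Y_def)
  finally have "T_ker_factor m r U T = transpose_mat (Y * ?Q) * U" .
  moreover have "Y * ?Q * transpose_mat (Y * ?Q) = Y * (?Q * ?Q) * transpose_mat Y"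
    using Y_carrier Q by (simp add: transpose_mult_dim mult_mat_assoc_dim)
  ultimately show ?thesis
    using gram_of_transpose_mult[of "Y * ?Q" m r U] Y_carrier Q(1) U by (simp add: psd(2) K_def)
qed

text \<open>\<open>Y J\<^sup>T\<close> has first block column \<open>Y\<close> and zeros elsewhere;
  subtracting it from the identity cancels the upper rows and leaves \<open>[-L, I]\<close>
  below.\<close>

private lemma zero_append_L:
  "0\<^sub>m r m @\<^sub>r append_cols (- L) (1\<^sub>m (m - r)) = 1\<^sub>m m - Y * transpose_mat J"
proof (rule eq_matI)
  have W: "append_cols (- L) (1\<^sub>m (m - r)) \<in> carrier_mat (m - r) m"
    using L_carrier r by (auto simp: append_cols_def)
  fix i j assume "i < dim_row (1\<^sub>m m - Y * transpose_mat J)" "j < dim_col (1\<^sub>m m - Y * transpose_mat J)"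
  then have ij: "i < m" "j < m" using Y_carrier by (auto simp: J_def)
  have "(1\<^sub>m m - Y * transpose_mat J) $$ (i, j) = (if i = j then 1 else 0) - (if j < r then Y $$ (i, j) else 0)"
    using ij Y_carrier mult_transpose_incl_mat_index[OF Y_carrier, of i j m]
    by (simp add: J_def del: index_mult_mat(1))
  also have "(if j < r then Y $$ (i, j) else 0) =
      (if j < r then (if i < r then (if i = j then 1 else 0) else L $$ (i - r, j)) else 0)"
    using ij r append_rows_index[OF one_carrier_mat L_carrier, of i j] by (simp add: Y_def)
  finally have *: "(1\<^sub>m m - Y * transpose_mat J) $$ (i, j) = (if i = j then 1 else 0) -
      (if j < r then (if i < r then (if i = j then 1 else 0) else L $$ (i - r, j)) else 0)" .
  have "(0\<^sub>m r m @\<^sub>r append_cols (- L) (1\<^sub>m (m - r))) $$ (i, j) =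
      (if i < r then 0 else append_cols (- L) (1\<^sub>m (m - r)) $$ (i - r, j))"
    using ij r by (subst append_rows_index[OF zero_carrier_mat W]) auto
  also have "\<dots> = (if i < r then 0 else if j < r then - L $$ (i - r, j) else if i = j then 1 else 0)"
    using ij r L_carrier by (auto simp: append_cols_def)
  finally show "(0\<^sub>m r m @\<^sub>r append_cols (- L) (1\<^sub>m (m - r))) $$ (i, j) = (1\<^sub>m m - Y * transpose_mat J) $$ (i, j)"
    using ij by (auto simp: *)
qed (use L_carrier Y_carrier r in \<open>auto simp: append_rows_def append_cols_def J_def\<close>)

private lemma gram_T_zero_factor:
  "transpose_mat (T_zero_factor m r U T) * T_zero_factor m r U T = transpose_mat U * (A - K) * U"
proof -
  let ?X = "sqrt_mat A" and ?W = "append_cols (- L) (1\<^sub>m (m - r))"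
  define Z where "Z = 1\<^sub>m m - Y * transpose_mat J"
  note psd = sqrt_mat_pos_semidef[OF pos_def_imp_pos_semidef[OF A_pos_def]]
  have X: "?X \<in> carrier_mat m m" "transpose_mat ?X = ?X"
    using psd(1) by (auto simp: pos_semidef_mats_def)
  have W: "?W \<in> carrier_mat (m - r) m"
    using L_carrier r by (auto simp: append_cols_def)
  have Z: "Z \<in> carrier_mat m m"
    using Y_carrier J_carrier unfolding Z_def by (intro minus_carrier_mat mult_carrier_mat[of _ m r]) auto
  have "T_zero_factor m r U T = transpose_mat (0\<^sub>m r m @\<^sub>r ?W * ?X) * U"
    by (simp add: T_zero_factor_def Let_def A_def L_def)
  also have "0\<^sub>m r m @\<^sub>r ?W * ?X = Z * ?X"
    using append_rows_mult[OF zero_carrier_mat W X(1), of r] X(1) zero_append_L by (simp add: Z_def)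
  finally have F: "T_zero_factor m r U T = transpose_mat (Z * ?X) * U" .
  have "Z * A = A - Y * (transpose_mat J * A)"
    using Y_carrier J_carrier A_carrier
    by (simp add: Z_def minus_mult_distrib_mat[of _ m m _ _ m] mult_mat_assoc_dim)
  then have ZA: "Z * A = A - K" by (simp add: K_eq(1))
  have "transpose_mat Z = 1\<^sub>m m - J * transpose_mat Y"
    using Y_carrier J_carrier by (simp add: Z_def transpose_minus[of _ m m] transpose_mult_dim)
  \<comment> \<open>Left multiplication by \<open>Z\<close> already gives \<open>A - K\<close>;
    multiplying by \<open>Z\<^sup>T\<close> on the right changes nothing, because
    \<open>(A - K) J\<close> vanishes.\<close>
  moreover have "(A - K) * (1\<^sub>m m - J * transpose_mat Y) = (A - K) - (A - K) * J * transpose_mat Y"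
    using Y_carrier J_carrier A_carrier K_carrier
    by (simp add: mult_minus_distrib_mat[of _ m m _ m] mult_mat_assoc_dim minus_carrier_mat)
  moreover have "(A - K) * J = 0\<^sub>m m r"
    using A_carrier K_carrier J_carrier
    by (simp add: minus_mult_distrib_mat[of _ m m _ _ r] K_mult_J)
  ultimately have "Z * A * transpose_mat Z = A - K"
    using Y_carrier A_carrier K_carrier unfolding ZA
    by (auto simp: left_mult_zero_mat[of _ r m])
  moreover have "Z * ?X * transpose_mat (Z * ?X) = Z * (?X * ?X) * transpose_mat Z"
    using Z X by (simp add: transpose_mult_dim mult_mat_assoc_dim)
  ultimately show ?thesis
    unfolding F using gram_of_transpose_mult[of "Z * ?X" m m U] Z X(1) U by (simp add: psd(2))
qed

private lemma T_eq: "T = transpose_mat U * K * U + transpose_mat U * (A - K) * U"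
proof -
  have Tc: "T \<in> carrier_mat m m" using T by (simp add: pos_def_mats_def)
  have "transpose_mat U * K * U + transpose_mat U * (A - K) * U = transpose_mat U * (K + (A - K)) * U"
    using U K_carrier A_carrier
    by (simp add: add_mult_distrib_mat[of _ m m _ _ m] mult_add_distrib_mat[of _ m m _ m] minus_carrier_mat)
  also have "K + (A - K) = A"
    using K_carrier A_carrier by (intro eq_matI) auto
  also have "transpose_mat U * A * U = (transpose_mat U * U) * T * (transpose_mat U * U)"
    unfolding A_def using U Tc by (simp add: mult_mat_assoc_dim)
  finally show ?thesis using Tc by (simp add: UtU)
qed

text \<open>The singular value decomposition enters only through its effect on \<open>B\<close>: the
  rows of \<open>U B\<close> after the first \<open>r\<close> are zero, and the upper rows
  \<open>C\<close> have full row rank, witnessed by \<open>G\<close>.\<close>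

lemma closed_form_decomposition:
  assumes B: "B \<in> carrier_mat m n" and C: "C \<in> carrier_mat r n" and G: "G \<in> carrier_mat n r"
    and CG: "C * G = 1\<^sub>m r" and UB: "U * B = J * C"
  defines "Tk \<equiv> transpose_mat (T_ker_factor m r U T) * T_ker_factor m r U T"
    and "T0 \<equiv> transpose_mat (T_zero_factor m r U T) * T_zero_factor m r U T"
  shows "Tk \<in> T_ker m B" "T0 \<in> T_zero m B" "T = Tk + T0"
proof -
  have Tk: "Tk = transpose_mat U * K * U" unfolding Tk_def by (rule gram_T_ker_factor)
  have T0: "T0 = transpose_mat U * (A - K) * U" unfolding T0_def by (rule gram_T_zero_factor)
  show "T = Tk + T0" unfolding Tk T0 by (rule T_eq)
  have carr: "Tk \<in> carrier_mat m m" "T0 \<in> carrier_mat m m"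
    using U K_carrier A_carrier by (auto simp: Tk T0 minus_carrier_mat)
  have "dim_col (T_ker_factor m r U T) = m" "dim_col (T_zero_factor m r U T) = m"
    using U by (simp_all add: T_ker_factor_def T_zero_factor_def Let_def)
  then have psd: "Tk \<in> pos_semidef_mats m" "T0 \<in> pos_semidef_mats m"
    unfolding Tk_def T0_def by (auto intro: gram_pos_semidef[OF carrier_matI[OF refl]])
  have "T0 * B = transpose_mat U * ((A - K) * J * C)"
    using U B C J_carrier A_carrier K_carrier
    by (simp add: T0 mult_mat_assoc_dim UB minus_carrier_mat)
  also have "(A - K) * J = 0\<^sub>m m r"
    using A_carrier K_carrier J_carrier
    by (simp add: minus_mult_distrib_mat[of _ m m _ _ r] K_mult_J)
  finally have "T0 * B = 0\<^sub>m m (dim_col B)" using U B C by (simp add: left_mult_zero_mat[of _ r n])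
  then show "T0 \<in> T_zero m B" using psd by (simp add: T_zero_def)
  have Tkt: "transpose_mat Tk = Tk" using psd(1) by (simp add: pos_semidef_mats_def)
  have "transpose_mat (Tk * B) = transpose_mat (U * B) * (K * U)"
    using U B K_carrier by (simp add: Tk transpose_mult_dim mult_mat_assoc_dim K_sym)
  also have "\<dots> = transpose_mat C * (transpose_mat (K * J) * U)"
    unfolding UB using U C J_carrier K_carrier by (simp add: transpose_mult_dim mult_mat_assoc_dim K_sym)
  also have "transpose_mat (K * J) = transpose_mat J * A"
    unfolding K_mult_J using A_carrier J_carrier by (simp add: transpose_mult_dim A_sym)
  finally have TkB: "transpose_mat (Tk * B) = transpose_mat C * (transpose_mat J * A * U)" .
  \<comment> \<open>\<open>G\<^sup>T\<close> removes the factor \<open>C\<^sup>T\<close> from the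
    transpose of \<open>Tk * B\<close>, and \<open>U\<^sup>T Y\<close> then rebuilds
    \<open>U\<^sup>T K U\<close> from \<open>J\<^sup>T A U\<close>.\<close>
  define Z where "Z = transpose_mat U * Y * transpose_mat G"
  have Z: "Z \<in> carrier_mat m n" using U Y_carrier G by (simp add: Z_def)
  have "Z * transpose_mat (Tk * B) = transpose_mat U * (Y * (transpose_mat (C * G) * (transpose_mat J * A * U)))"
    unfolding TkB Z_def using U Y_carrier G C J_carrier A_carrier
    by (simp add: transpose_mult_dim mult_mat_assoc_dim)
  also have "\<dots> = Tk"
    unfolding Tk K_eq(1) CG using U Y_carrier J_carrier A_carrier by (simp add: mult_mat_assoc_dim)
  finally have "left_kernel (Tk * B) \<subseteq> left_kernel Tk"
    using carr B Z Tkt by (intro left_kernel_subset[of Tk m m "Tk * B" n Z]) auto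
  \<comment> \<open>This inclusion is general: right multiplication by \<open>B\<close> cannot
    shrink a left kernel.\<close>
  moreover have "left_kernel Tk \<subseteq> left_kernel (Tk * B)"
    using carr B by (intro left_kernel_subset[of _ m n _ m "transpose_mat B"]) (auto simp: transpose_mult_dim)
  ultimately show "Tk \<in> T_ker m B" using psd by (auto simp: T_ker_def)
qed

end

text \<open>With \<open>P = U B\<close> the decomposition reads
  \<open>P R P\<^sup>T = \<Sigma>\<close>, so the rows of \<open>P\<close> are orthogonal for the
  inner product of \<open>R\<close> and have the diagonal of \<open>\<Sigma>\<close> as squared
  norms. Zero entries therefore mean zero rows, and the descending order puts these last.\<close>

lemma svd_gram_factorization:
  assumes B: "B \<in> carrier_mat m n" and R: "R \<in> pos_def_mats n"
    and svd: "is_svd m (B * R * transpose_mat B) U \<Sigma>"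
  obtains p C G where "p \<le> m" "C \<in> carrier_mat p n" "G \<in> carrier_mat n p" "C * G = 1\<^sub>m p"
    "U * B = incl_mat m p * C"
    "\<Sigma> = four_block_mat (leading_submatrix \<Sigma> p) (0\<^sub>m p (m - p)) (0\<^sub>m (m - p) p) (0\<^sub>m (m - p) (m - p))"
proof -
  have U: "U \<in> carrier_mat m m" and S: "\<Sigma> \<in> carrier_mat m m" and diag: "diagonal_mat \<Sigma>"
    and nonneg: "\<And>i. i < m \<Longrightarrow> 0 \<le> \<Sigma> $$ (i, i)"
    and dec: "\<And>i j. i \<le> j \<Longrightarrow> j < m \<Longrightarrow> \<Sigma> $$ (j, j) \<le> \<Sigma> $$ (i, i)"
    using svd by (auto simp: is_svd_def)
  have Rc: "R \<in> carrier_mat n n" using R by (simp add: pos_def_mats_def)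
  \<comment> \<open>The index of the first zero on the diagonal; the disjunct \<open>i = m\<close>
    supplies a value when there is none and bounds \<open>p\<close> by \<open>m\<close>.\<close>
  define p where "p = (LEAST i. i = m \<or> \<Sigma> $$ (i, i) = 0)"
  have p: "p = m \<or> \<Sigma> $$ (p, p) = 0" unfolding p_def by (rule LeastI[of _ m]) simp
  have pm: "p \<le> m" unfolding p_def by (rule Least_le) simp
  have nz: "\<Sigma> $$ (i, i) \<noteq> 0" if "i < p" for i
    using not_less_Least[of i "\<lambda>i. i = m \<or> \<Sigma> $$ (i, i) = 0"] that by (auto simp: p_def)
  have z: "\<Sigma> $$ (i, i) = 0" if "p \<le> i" "i < m" for i
    using p dec[OF that] nonneg[OF that(2)] that by auto
  have Sij: "\<Sigma> $$ (i, j) = (if i = j \<and> i < p then \<Sigma> $$ (i, i) else 0)" if "i < m" "j < m" for i j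
    using diag S z[of i] that by (cases "i < p") (auto simp: diagonal_mat_def)
  define P where "P = U * B"
  have P: "P \<in> carrier_mat m n" using U B by (simp add: P_def)
  have "P * R * transpose_mat P = U * (B * R * transpose_mat B) * transpose_mat U"
    using U B Rc by (simp add: P_def transpose_mult_dim mult_mat_assoc_dim)
  then have PRP: "P * R * transpose_mat P = \<Sigma>" using is_svd_diagonal[OF svd] by simp
  have rc: "row P i \<in> carrier_vec n" if "i < m" for i using P that by auto
  have PR: "row P i \<bullet> (R *\<^sub>v row P j) = \<Sigma> $$ (i, j)" if "i < m" "j < m" for i j
    using that P Rc rc unfolding PRP[symmetric] by (simp add: mult_mat_assoc_dim mult_mat_vec_def)
  have zero_row: "row P i = 0\<^sub>v n" if "p \<le> i" "i < m" for i
    using PR[of i i] z[OF that] R rc[of i] that unfolding pos_def_mats_def by force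
  define C where "C = mat p n (\<lambda>(i, j). P $$ (i, j))"
  have C: "C \<in> carrier_mat p n" by (simp add: C_def)
  have rowC: "row C i = row P i" if "i < p" for i
    using that P pm by (intro eq_vecI) (auto simp: C_def)
  define D where "D = mat p p (\<lambda>(i, j). if i = j then 1 / \<Sigma> $$ (i, i) else 0)"
  have D: "D \<in> carrier_mat p p" "diagonal_mat D" by (auto simp: D_def diagonal_mat_def)
  \<comment> \<open>\<open>C R C\<^sup>T\<close> is the leading block of \<open>\<Sigma>\<close>,
    whose diagonal has no zeros, and \<open>D\<close> is its inverse.\<close>
  define G where "G = R * transpose_mat C * D"
  have G: "G \<in> carrier_mat n p" using Rc C D by (simp add: G_def)
  have "C * G = C * R * transpose_mat C * D"
    using Rc C D by (simp add: G_def mult_mat_assoc_dim)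
  also have "\<dots> = 1\<^sub>m p"
  proof (rule eq_matI)
    have CRC: "C * R * transpose_mat C \<in> carrier_mat p p"
      using C Rc by (auto intro: mult_carrier_mat[of _ _ n])
    fix i j assume "i < dim_row (1\<^sub>m p :: real mat)" "j < dim_col (1\<^sub>m p :: real mat)"
    then have ij: "i < p" "j < p" by auto
    have "(C * R * transpose_mat C) $$ (i, j) = row C i \<bullet> (R *\<^sub>v row C j)"
      using ij C Rc by (simp add: mult_mat_assoc_dim mult_mat_vec_def)
    also have "\<dots> = \<Sigma> $$ (i, j)" using ij pm by (simp add: rowC PR)
    finally show "(C * R * transpose_mat C * D) $$ (i, j) = 1\<^sub>m p $$ (i, j)"
      using mult_diagonal_entry[OF D CRC ij] ij pm nz Sij[of i j]
      by (auto simp: D_def simp del: index_mult_mat(1) assoc_mult_mat)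
  qed (use C D in auto)
  finally have CG: "C * G = 1\<^sub>m p" .
  have UB: "U * B = incl_mat m p * C"
  proof (rule eq_matI)
    fix i j assume "i < dim_row (incl_mat m p * C)" "j < dim_col (incl_mat m p * C)"
    then have ij: "i < m" "j < n" using C by auto
    have "(incl_mat m p * C) $$ (i, j) = (transpose_mat C * transpose_mat (incl_mat m p)) $$ (j, i)"
      using ij C arg_cong[OF transpose_mult_dim[of "incl_mat m p" C], of "\<lambda>M. M $$ (j, i)"]
      by (simp del: index_mult_mat(1))
    also have "\<dots> = (if i < p then P $$ (i, j) else 0)"
      using ij C pm mult_transpose_incl_mat_index[of "transpose_mat C" n p j i m] by (simp add: C_def)
    also have "\<dots> = P $$ (i, j)"
    proof (cases "i < p")
      case False
      then have "P $$ (i, j) = row P i $ j" using ij P by simp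
      also have "\<dots> = 0" using zero_row[of i] False ij by simp
      finally show ?thesis using False by simp
    qed simp
    finally show "(U * B) $$ (i, j) = (incl_mat m p * C) $$ (i, j)" by (simp add: P_def)
  qed (use U B C in auto)
  note S1 = leading_submatrix_carrier[OF S pm]
  have "\<Sigma> = four_block_mat (leading_submatrix \<Sigma> p) (0\<^sub>m p (m - p)) (0\<^sub>m (m - p) p) (0\<^sub>m (m - p) (m - p))"
    using S S1 pm by (intro eq_matI) (auto simp: Sij)
  with that[OF pm C G CG UB] show ?thesis .
qed

theorem theorem3:
  fixes S n :: nat and B R T :: "real mat"
  assumes "B \<in> carrier_mat S n" and "B \<noteq> 0\<^sub>m S n"
    and "R \<in> pos_def_mats n"
    and "T \<in> pos_def_mats S"
  shows "(\<exists>Tk \<in> T_ker S B. \<exists>T0 \<in> T_zero S B. T = Tk + T0) \<and>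
    (\<forall>U \<Sigma>. is_svd S (B * inv_mat R * transpose_mat B) U \<Sigma> \<longrightarrow>
      (let r = vec_space.rank S B;
           Fk = T_ker_factor S r U T;
           F0 = T_zero_factor S r U T;
           Tk = transpose_mat Fk * Fk;
           T0 = transpose_mat F0 * F0
       in \<Sigma> = four_block_mat (leading_submatrix \<Sigma> r) (0\<^sub>m r (S - r))
                              (0\<^sub>m (S - r) r) (0\<^sub>m (S - r) (S - r)) \<and>
          Tk \<in> T_ker S B \<and> T0 \<in> T_zero S B \<and> T = Tk + T0))"
proof -
  note B = assms(1)
  \<comment> \<open>The inverse of \<open>R\<close> is the positive definite weight in the
    decomposed matrix.\<close>
  note R' = pos_def_inv[OF assms(3)]
  let ?r = "vec_space.rank S B"
  have main: "\<Sigma> = four_block_mat (leading_submatrix \<Sigma> ?r) (0\<^sub>m ?r (S - ?r)) (0\<^sub>m (S - ?r) ?r) (0\<^sub>m (S - ?r) (S - ?r)) \<and>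
      transpose_mat (T_ker_factor S ?r U T) * T_ker_factor S ?r U T \<in> T_ker S B \<and>
      transpose_mat (T_zero_factor S ?r U T) * T_zero_factor S ?r U T \<in> T_zero S B \<and>
      T = transpose_mat (T_ker_factor S ?r U T) * T_ker_factor S ?r U T +
        transpose_mat (T_zero_factor S ?r U T) * T_zero_factor S ?r U T"
    if svd: "is_svd S (B * inv_mat R * transpose_mat B) U \<Sigma>" for U \<Sigma>
  proof -
    have U: "U \<in> carrier_mat S S" and UtU: "transpose_mat U * U = 1\<^sub>m S" and UUt: "U * transpose_mat U = 1\<^sub>m S"
      using svd by (auto simp: is_svd_def)
    obtain p C G where p: "p \<le> S" and C: "C \<in> carrier_mat p n" and G: "G \<in> carrier_mat n p"
      and CG: "C * G = 1\<^sub>m p" and UB: "U * B = incl_mat S p * C"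
      and blocks: "\<Sigma> = four_block_mat (leading_submatrix \<Sigma> p) (0\<^sub>m p (S - p)) (0\<^sub>m (S - p) p) (0\<^sub>m (S - p) (S - p))"
      using svd_gram_factorization[OF B R' svd] by blast
    \<comment> \<open>It remains to identify \<open>p\<close>, read off \<open>\<Sigma>\<close>,
      with the rank of \<open>B\<close>. The first \<open>p\<close> columns of
      \<open>U\<^sup>T\<close> form the full-rank factor, with left inverse
      \<open>J\<^sup>T U\<close>.\<close>
    let ?J = "incl_mat S p" and ?E = "transpose_mat U * incl_mat S p"
    have "transpose_mat U * (U * B) = B"
      using U B by (simp add: UtU flip: assoc_mult_mat[of _ S S _ S _ n])
    then have BE: "B = ?E * C" using U C by (simp add: UB mult_mat_assoc_dim)
    have E: "?E \<in> carrier_mat S p" and F: "transpose_mat ?J * U \<in> carrier_mat p S"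
      using U by (auto intro: mult_carrier_mat[of _ _ S])
    have "?E * C * G = ?E"
      using assoc_mult_mat[OF E C G] CG right_mult_one_mat[OF E] by simp
    then have EB: "?E = B * G" unfolding BE[symmetric] by (rule sym)
    have "transpose_mat ?J * U * ?E = transpose_mat ?J * ((U * transpose_mat U) * ?J)"
      using U by (simp add: mult_mat_assoc_dim)
    also have "\<dots> = 1\<^sub>m p" by (simp add: UUt transpose_incl_mat_mult_incl_mat[OF p] left_mult_one_mat[of _ S])
    finally have "?r = p" by (rule rank_full_rank_factor[OF B E C G F BE EB])
    then show ?thesis
      using closed_form_decomposition[OF assms(4) U UtU UUt p B C G CG UB] blocks by simp
  qed
  \<comment> \<open>Semidefiniteness provides some decomposition, so the existence claim follows
    from the closed forms.\<close>
  have "B * inv_mat R * transpose_mat B \<in> pos_semidef_mats S"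
    by (rule pos_semidef_congruence[OF pos_def_imp_pos_semidef[OF R'] B])
  from svd_exists[OF this] main show ?thesis unfolding Let_def by blast
qed

end
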